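(* Let $A$ and $B$ be commuting operators with closed range on a complex Hilbert space such that $A$ is both posinormal and coposinormal and $B$ is posinormal. Then $AB$ is posinormal with closed range.
   Context: An operator is a bounded linear transformation of a Hilbert space into itself. $\mathcal{R}(T)$ denotes the range of $T$. An operator $T$ is posinormal if $\mathcal{R}(T)\subseteq\mathcal{R}(T^* )$, and coposinormal if $T^*$ is posinormal. *)

theory Defs
  imports "HOL-Analysis.Analysis"
begin

text \<open>
  Complex inner product spaces, on top of the normed spaces of the library: the norm (hence the
  metric, the topology and completeness) is the one induced by the inner product, and real scalars
  act through the complex ones. The inner product is linear in its first argument.
\<close>

class complex_inner = real_normed_vector +
  fixes scaleC :: "complex \<Rightarrow> 'a \<Rightarrow> 'a" (infixr "*\<^sub>C" 75)
    and cinner :: "'a \<Rightarrow> 'a \<Rightarrow> complex"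
  assumes scaleC_add_right: "a *\<^sub>C (x + y) = a *\<^sub>C x + a *\<^sub>C y"
    and scaleC_add_left: "(a + b) *\<^sub>C x = a *\<^sub>C x + b *\<^sub>C x"
    and scaleC_scaleC: "a *\<^sub>C (b *\<^sub>C x) = (a * b) *\<^sub>C x"
    and scaleC_of_real: "complex_of_real r *\<^sub>C x = r *\<^sub>R x"
    and cinner_commute: "cinner x y = cnj (cinner y x)"
    and cinner_add_left: "cinner (x + y) z = cinner x z + cinner y z"
    and cinner_scaleC_left: "cinner (a *\<^sub>C x) y = a * cinner x y"
    and cinner_self: "cinner x x = complex_of_real ((norm x)\<^sup>2)"

class complex_hilbert_space = complex_inner + complete_space

instantiation complex :: complex_hilbert_space
begin

definition scaleC_complex :: "complex \<Rightarrow> complex \<Rightarrow> complex"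
  where "scaleC_complex a x = a * x"

definition cinner_complex :: "complex \<Rightarrow> complex \<Rightarrow> complex"
  where "cinner_complex x y = x * cnj y"

instance
proof
  show "cinner x x = complex_of_real ((norm x)\<^sup>2)" for x :: complex
    unfolding cinner_complex_def by (rule complex_norm_square [symmetric])
qed (simp_all add: scaleC_complex_def cinner_complex_def algebra_simps scaleR_conv_of_real)

end

definition bounded_operator :: "('a::complex_hilbert_space \<Rightarrow> 'a) \<Rightarrow> bool"
  where "bounded_operator T \<longleftrightarrow>
    bounded_linear T \<and> (\<forall>a x. T (a *\<^sub>C x) = a *\<^sub>C T x)"

text \<open>Meaningful for bounded operators, whose adjoint exists and is unique.\<close>

definition cadjoint ::
    "('a::complex_hilbert_space \<Rightarrow> 'a) \<Rightarrow> ('a \<Rightarrow> 'a)"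
  where "cadjoint T =
    (THE S. bounded_operator S \<and> (\<forall>x y. cinner (T x) y = cinner x (S y)))"

definition posinormal :: "('a::complex_hilbert_space \<Rightarrow> 'a) \<Rightarrow> bool"
  where "posinormal T \<longleftrightarrow> range T \<subseteq> range (cadjoint T)"

definition coposinormal :: "('a::complex_hilbert_space \<Rightarrow> 'a) \<Rightarrow> bool"
  where "coposinormal T \<longleftrightarrow> posinormal (cadjoint T)"

end

theory Submission
  imports Defs
begin

text \<open>
  For an operator \<open>A\<close> with closed range that is posinormal and coposinormal, the ranges of \<open>A\<close> and
  \<open>A\<^sup>*\<close> coincide. The orthogonal complement of the closed space \<open>range A\<close> is the kernel of \<open>A\<^sup>*\<close>,
  that of \<open>range A\<^sup>*\<close> is the kernel of \<open>A\<close>; so the range and the kernel of \<open>A\<close> are complementary,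
  and the same holds for \<open>A\<^sup>*\<close> (lemma \<open>range_kernel_complementary\<close>).

  Complementarity alone forces \<open>range (A \<circ> T) = range A \<inter> range T\<close> for every additive \<open>T\<close> that
  commutes with \<open>A\<close>, because such a \<open>T\<close> respects the decomposition (lemma \<open>range_comp_eq_Int\<close>).
  Apply this to the pair \<open>A, B\<close> and to the commuting pair \<open>A\<^sup>*, B\<^sup>*\<close>. The first equation exhibits
  \<open>range (A \<circ> B)\<close> as an intersection of two closed sets. As \<open>(A \<circ> B)\<^sup>* = A\<^sup>* \<circ> B\<^sup>*\<close>, both together
  give \<open>range (A \<circ> B) = range A \<inter> range B \<subseteq> range A\<^sup>* \<inter> range B\<^sup>* = range (A \<circ> B)\<^sup>*\<close>.

  What remains is the basic theory of Hilbert spaces behind adjoints: the existence of orthogonal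
  projections onto closed subspaces, from it the Riesz representation of bounded functionals, and
  from that the existence of adjoints.
\<close>

section \<open>Inner products\<close>

lemma cinner_add_right: "cinner x (y + z) = cinner x y + cinner x (z::'a::complex_inner)"
  by (metis cinner_add_left cinner_commute complex_cnj_add)

lemma cinner_scaleC_right: "cinner x (a *\<^sub>C y) = cnj a * cinner x (y::'a::complex_inner)"
  by (metis cinner_commute cinner_scaleC_left complex_cnj_mult)

lemma scaleC_minus_one: "(-1) *\<^sub>C x = - (x::'a::complex_inner)"
  using scaleC_of_real[of "-1" x] by simp

lemma cinner_minus_left: "cinner (- x) y = - cinner x (y::'a::complex_inner)"
  by (metis scaleC_minus_one cinner_scaleC_left mult_minus1)

lemma cinner_minus_right: "cinner x (- y) = - cinner x (y::'a::complex_inner)"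
  by (metis cinner_commute cinner_minus_left complex_cnj_minus)

lemma cinner_diff_left: "cinner (x - y) z = cinner x z - cinner y (z::'a::complex_inner)"
  using cinner_add_left[of x "- y" z] by (simp add: cinner_minus_left)

lemma cinner_diff_right: "cinner x (y - z) = cinner x y - cinner x (z::'a::complex_inner)"
  using cinner_add_right[of x y "- z"] by (simp add: cinner_minus_right)

lemma cinner_zero_left: "cinner 0 (x::'a::complex_inner) = 0"
  using cinner_diff_left[of 0 0 x] by simp

lemma cinner_zero_right: "cinner (x::'a::complex_inner) 0 = 0"
  using cinner_diff_right[of x 0 0] by simp

lemma cinner_self_eq_zero: "cinner x x = 0 \<longleftrightarrow> x = (0::'a::complex_inner)"
  by (simp add: cinner_self)

lemma cinner_left_eqI:
  fixes y z :: "'a::complex_inner"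
  assumes "\<And>x. cinner x y = cinner x z"
  shows "y = z"
proof -
  have "cinner (y - z) (y - z) = 0"
    by (simp add: cinner_diff_right assms)
  then show ?thesis
    by (simp add: cinner_self_eq_zero)
qed

lemma power2_norm_eq_Re_cinner: "(norm x)\<^sup>2 = Re (cinner x (x::'a::complex_inner))"
  by (simp add: cinner_self)

lemma parallelogram_law:
  fixes x y :: "'a::complex_inner"
  shows "(norm (x + y))\<^sup>2 + (norm (x - y))\<^sup>2 = 2 * (norm x)\<^sup>2 + 2 * (norm y)\<^sup>2"
  by (simp add: power2_norm_eq_Re_cinner cinner_add_left cinner_add_right
      cinner_diff_left cinner_diff_right)

text \<open>
  Choosing the phase of the coefficient to be that of \<open>cinner x y\<close> makes the cross term real, so
  that a real quadratic polynomial in \<open>t\<close> remains. Its nonnegativity at the minimum is the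
  Cauchy-Schwarz inequality; that it has its minimum at \<open>t = 0\<close> means that \<open>x\<close> and \<open>y\<close> are orthogonal.
\<close>

lemma power2_norm_diff_component:
  fixes x y :: "'a::complex_inner"
  defines "a \<equiv> cinner x y"
  shows "(norm (x - (complex_of_real t * a) *\<^sub>C y))\<^sup>2 =
    (norm x)\<^sup>2 - 2 * t * (cmod a)\<^sup>2 + t\<^sup>2 * (cmod a)\<^sup>2 * (norm y)\<^sup>2"
proof -
  have yx: "cinner y x = cnj a"
    unfolding a_def by (rule cinner_commute)
  have yy: "cinner y y = complex_of_real ((norm y)\<^sup>2)" and xx: "cinner x x = complex_of_real ((norm x)\<^sup>2)"
    by (rule cinner_self)+
  have cm: "(cmod a)\<^sup>2 = Re a * Re a + Im a * Im a"
    by (simp only: cmod_power2) (simp only: power2_eq_square)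
  show ?thesis
    unfolding power2_norm_eq_Re_cinner[of "x - _"] cm
    by (simp add: cinner_diff_left cinner_diff_right cinner_scaleC_left cinner_scaleC_right
        yx a_def[symmetric] yy xx)
      (simp add: algebra_simps power2_eq_square)
qed

lemma norm_cinner_le:
  fixes x y :: "'a::complex_inner"
  shows "cmod (cinner x y) \<le> norm x * norm y"
proof (cases "y = 0")
  case True
  then show ?thesis by (simp add: cinner_zero_right)
next
  case False
  define n where "n = (norm y)\<^sup>2"
  have n: "n > 0" using False by (simp add: n_def)
  let ?c = "(cmod (cinner x y))\<^sup>2"
  have "0 \<le> (norm x)\<^sup>2 - 2 * (1 / n) * ?c + (1 / n)\<^sup>2 * ?c * n"
    unfolding n_def power2_norm_diff_component[symmetric] by simp
  also have "\<dots> = (norm x)\<^sup>2 - ?c / n"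
    using n by (simp add: field_simps power2_eq_square)
  finally have "?c \<le> (norm x * norm y)\<^sup>2"
    using n by (simp add: field_simps n_def power_mult_distrib)
  then show ?thesis
    by (rule power2_le_imp_le) simp
qed

section \<open>Orthogonal projections\<close>

text \<open>
  A minimizing sequence for the distance to a convex set is Cauchy: midpoints stay in the set, so by
  the parallelogram law two almost closest points are close to each other.
\<close>

lemma closest_point_exists:
  fixes M :: "'a::complex_hilbert_space set"
  assumes "closed M" and "convex M" and "M \<noteq> {}"
  shows "\<exists>p\<in>M. \<forall>m\<in>M. norm (x - p) \<le> norm (x - m)"
proof -
  define d where "d = infdist x M"
  have d0: "d \<ge> 0"
    by (simp add: d_def infdist_nonneg)
  have d_le: "d \<le> norm (x - m)" if "m \<in> M" for m
    using infdist_le[OF that, of x] by (simp add: d_def dist_norm)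
  have d_sq: "d\<^sup>2 \<le> (norm (x - m))\<^sup>2" if "m \<in> M" for m
    using d_le[OF that] d0 by (rule power_mono)
  have "\<exists>m\<in>M. (norm (x - m))\<^sup>2 < d\<^sup>2 + e" if "e > 0" for e
  proof -
    have "d < sqrt (d\<^sup>2 + e)"
      by (rule real_less_rsqrt) (use that in simp)
    then obtain m where "m \<in> M" "dist x m < sqrt (d\<^sup>2 + e)"
      using \<open>M \<noteq> {}\<close> unfolding d_def infdist_def
      by (auto simp: cInf_less_iff)
    moreover have "(sqrt (d\<^sup>2 + e))\<^sup>2 = d\<^sup>2 + e"
      using that by simp
    ultimately show ?thesis
      by (metis dist_norm norm_ge_zero power_strict_mono zero_less_numeral)
  qed
  then have "\<exists>m\<in>M. (norm (x - m))\<^sup>2 < d\<^sup>2 + 1 / real (Suc n)" for n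
    by simp
  then obtain u where uM: "\<And>n. u n \<in> M"
    and u: "\<And>n. (norm (x - u n))\<^sup>2 < d\<^sup>2 + 1 / real (Suc n)"
    by metis
  have close: "(norm (u m - u n))\<^sup>2 \<le> 2 / real (Suc m) + 2 / real (Suc n)" for m n
  proof -
    let ?c = "(1/2) *\<^sub>R u m + (1/2) *\<^sub>R u n"
    have "?c \<in> M"
      using \<open>convex M\<close> uM by (intro convexD) auto
    moreover have "(x - u m) + (x - u n) = 2 *\<^sub>R (x - ?c)"
      by (simp add: algebra_simps scaleR_2)
    then have "(norm ((x - u m) + (x - u n)))\<^sup>2 = 4 * (norm (x - ?c))\<^sup>2"
      by (simp add: power_mult_distrib)
    ultimately have "4 * d\<^sup>2 \<le> (norm ((x - u m) + (x - u n)))\<^sup>2"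
      using d_sq by simp
    moreover have "norm ((x - u m) - (x - u n)) = norm (u m - u n)"
      by (simp add: norm_minus_commute)
    ultimately show ?thesis
      using parallelogram_law[of "x - u m" "x - u n"] u[of m] u[of n] by simp
  qed
  have "Cauchy u"
  proof (rule metric_CauchyI)
    fix e :: real
    assume e: "e > 0"
    obtain N where N: "4 / e\<^sup>2 < real (Suc N)"
      using reals_Archimedean2[of "4 / e\<^sup>2"] by (metis less_trans lessI of_nat_less_iff)
    have "dist (u m) (u n) < e" if "m \<ge> N" "n \<ge> N" for m n
    proof -
      have "2 / real (Suc m) \<le> 2 / real (Suc N)" "2 / real (Suc n) \<le> 2 / real (Suc N)"
        using that by (auto intro!: divide_left_mono)
      with close[of m n] have "(norm (u m - u n))\<^sup>2 \<le> 4 / real (Suc N)"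
        by simp
      also have "\<dots> < e\<^sup>2"
        using N e by (simp add: field_simps)
      finally show ?thesis
        using e by (simp add: dist_norm power_less_imp_less_base)
    qed
    then show "\<exists>N. \<forall>m\<ge>N. \<forall>n\<ge>N. dist (u m) (u n) < e"
      by blast
  qed
  then obtain p where p: "u \<longlonglongrightarrow> p"
    using Cauchy_convergent convergent_def by blast
  have "p \<in> M"
    using \<open>closed M\<close> uM p by (rule closed_sequentially)
  moreover have "norm (x - p) \<le> d"
  proof -
    have "(\<lambda>n. (norm (x - u n))\<^sup>2) \<longlonglongrightarrow> (norm (x - p))\<^sup>2"
      by (intro tendsto_intros p)
    moreover have "(\<lambda>n. d\<^sup>2 + 1 / real (Suc n)) \<longlonglongrightarrow> d\<^sup>2 + 0"
      using LIMSEQ_inverse_real_of_nat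
      by (intro tendsto_add tendsto_const) (simp add: inverse_eq_divide)
    ultimately have "(norm (x - p))\<^sup>2 \<le> d\<^sup>2 + 0"
      by (rule LIMSEQ_le) (use u less_imp_le in blast)
    then show ?thesis
      using power2_le_imp_le[OF _ d0] by simp
  qed
  ultimately show ?thesis
    using d_le order_trans by blast
qed

lemma orthogonal_projection_exists:
  fixes M :: "'a::complex_hilbert_space set"
  assumes "closed M" and "0 \<in> M"
    and add: "\<And>x y. x \<in> M \<Longrightarrow> y \<in> M \<Longrightarrow> x + y \<in> M"
    and scale: "\<And>c x. x \<in> M \<Longrightarrow> c *\<^sub>C x \<in> M"
  shows "\<exists>p\<in>M. \<forall>m\<in>M. cinner (x - p) m = 0"
proof -
  have "convex M"
    by (rule convexI) (metis add scale scaleC_of_real)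
  then obtain p where p: "p \<in> M" and le: "\<And>m. m \<in> M \<Longrightarrow> norm (x - p) \<le> norm (x - m)"
    using closest_point_exists[OF \<open>closed M\<close>, of x] \<open>0 \<in> M\<close> by blast
  have "cinner (x - p) m = 0" if m: "m \<in> M" for m
  proof (rule ccontr)
    assume "cinner (x - p) m \<noteq> 0"
    then have a: "0 < (cmod (cinner (x - p) m))\<^sup>2" (is "0 < ?a")
      by simp
    \<comment> \<open>A step length small enough for the linear term of the quadratic polynomial to dominate.\<close>
    define t where "t = 1 / ((norm m)\<^sup>2 + 1)"
    have pos: "0 < (norm m)\<^sup>2 + 1"
      by (simp add: add_nonneg_pos)
    then have t: "t > 0" "t * (norm m)\<^sup>2 < 1"
      by (auto simp: t_def)
    let ?c = "complex_of_real t * cinner (x - p) m"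
    have "norm (x - p) \<le> norm (x - (p + ?c *\<^sub>C m))"
      by (intro le add p scale m)
    then have "(norm (x - p))\<^sup>2 \<le> (norm (x - p - ?c *\<^sub>C m))\<^sup>2"
      by (simp add: diff_diff_eq)
    then have "0 \<le> (t * ?a) * (t * (norm m)\<^sup>2 - 2)"
      unfolding power2_norm_diff_component by (simp add: algebra_simps power2_eq_square)
    moreover have "(t * ?a) * (t * (norm m)\<^sup>2 - 2) < 0"
      using t a by (intro mult_pos_neg) auto
    ultimately show False
      by simp
  qed
  with p show ?thesis
    by blast
qed

section \<open>Adjoints\<close>

text \<open>
  A nonzero functional is determined up to a factor by its kernel, so a vector orthogonal to the
  kernel represents it after rescaling.
\<close>

lemma riesz_representation:
  fixes f :: "'a::complex_hilbert_space \<Rightarrow> complex"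
  assumes "bounded_linear f" and scale: "\<And>c x. f (c *\<^sub>C x) = c * f x"
  shows "\<exists>z. \<forall>x. f x = cinner x z"
proof (cases "\<forall>x. f x = 0")
  case True
  then show ?thesis
    by (metis cinner_zero_right)
next
  case False
  then obtain x0 where x0: "f x0 \<noteq> 0"
    by blast
  interpret f: bounded_linear f by fact
  let ?K = "f -` {0}"
  have "closed ?K"
    by (intro closed_vimage f.continuous_on continuous_on_id) simp
  then obtain p where p: "f p = 0" and orth: "\<And>m. f m = 0 \<Longrightarrow> cinner (x0 - p) m = 0"
    using orthogonal_projection_exists[of ?K x0] by (auto simp: f.add f.zero scale)
  define z where "z = x0 - p"
  have fz: "f z \<noteq> 0"
    using x0 p by (simp add: z_def f.diff)
  then have "z \<noteq> 0"
    using f.zero by auto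
  then have zz: "cinner z z \<noteq> 0"
    by (simp add: cinner_self_eq_zero)
  have "f x = cinner x (cnj (f z / cinner z z) *\<^sub>C z)" for x
  proof -
    have "f (f z *\<^sub>C x - f x *\<^sub>C z) = 0"
      by (simp add: f.diff scale)
    then have "cinner z (f z *\<^sub>C x - f x *\<^sub>C z) = 0"
      using orth by (simp add: z_def)
    then have "cinner (f z *\<^sub>C x - f x *\<^sub>C z) z = 0"
      by (metis cinner_commute complex_cnj_zero)
    then have "f z * cinner x z = f x * cinner z z"
      by (simp add: cinner_diff_left cinner_scaleC_left)
    then show ?thesis
      using zz by (simp add: cinner_scaleC_right field_simps)
  qed
  then show ?thesis
    by blast
qed

lemma adjoint_exists:
  fixes T :: "'a::complex_hilbert_space \<Rightarrow> 'a"
  assumes "bounded_operator T"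
  shows "\<exists>S. bounded_operator S \<and> (\<forall>x y. cinner (T x) y = cinner x (S y))"
proof -
  interpret T: bounded_linear T
    using assms by (simp add: bounded_operator_def)
  have scale: "T (c *\<^sub>C x) = c *\<^sub>C T x" for c x
    using assms by (simp add: bounded_operator_def)
  obtain K where K: "K \<ge> 0" "\<And>x. norm (T x) \<le> norm x * K"
    using T.nonneg_bounded by blast
  have "\<exists>z. \<forall>x. cinner (T x) y = cinner x z" for y
  proof (rule riesz_representation)
    show "bounded_linear (\<lambda>x. cinner (T x) y)"
    proof (rule bounded_linear_intro)
      show "cinner (T (a + b)) y = cinner (T a) y + cinner (T b) y" for a b
        by (simp add: T.add cinner_add_left)
      show "cinner (T (r *\<^sub>R a)) y = r *\<^sub>R cinner (T a) y" for r a
        by (simp add: scale cinner_scaleC_left scaleR_conv_of_real flip: scaleC_of_real)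
      show "norm (cinner (T a) y) \<le> norm a * (K * norm y)" for a
      proof -
        have "norm (cinner (T a) y) \<le> norm (T a) * norm y"
          by (rule norm_cinner_le)
        also have "\<dots> \<le> norm a * K * norm y"
          using K by (intro mult_right_mono) auto
        finally show ?thesis
          by (simp add: mult.assoc)
      qed
    qed
    show "cinner (T (c *\<^sub>C x)) y = c * cinner (T x) y" for c x
      by (simp add: scale cinner_scaleC_left)
  qed
  then obtain S where S: "\<And>x y. cinner (T x) y = cinner x (S y)"
    by metis
  have scaleS: "S (c *\<^sub>C y) = c *\<^sub>C S y" for c y
    by (rule cinner_left_eqI) (simp add: cinner_scaleC_right flip: S)
  have "bounded_linear S"
  proof (rule bounded_linear_intro)
    show "S (a + b) = S a + S b" for a b
      by (rule cinner_left_eqI) (simp add: cinner_add_right flip: S)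
    show "S (r *\<^sub>R a) = r *\<^sub>R S a" for r a
      by (metis scaleS scaleC_of_real)
    show "norm (S y) \<le> norm y * K" for y
    proof (cases "S y = 0")
      case False
      have "norm (S y) * norm (S y) = cmod (cinner (S y) (S y))"
        unfolding cinner_self norm_of_real by (simp add: power2_eq_square)
      also have "\<dots> = cmod (cinner (T (S y)) y)"
        by (simp add: S)
      also have "\<dots> \<le> norm (T (S y)) * norm y"
        by (rule norm_cinner_le)
      also have "\<dots> \<le> norm (S y) * K * norm y"
        using K by (intro mult_right_mono) auto
      finally have "norm (S y) * norm (S y) \<le> norm (S y) * (norm y * K)"
        by (simp add: mult_ac)
      then show ?thesis
        using False by simp
    qed (simp add: K)
  qed
  with S scaleS show ?thesis
    unfolding bounded_operator_def by blast
qed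

lemma adjoint_unique:
  fixes T :: "'a::complex_hilbert_space \<Rightarrow> 'a"
  assumes "bounded_operator S" and "\<And>x y. cinner (T x) y = cinner x (S y)"
  shows "cadjoint T = S"
  unfolding cadjoint_def
proof (rule the_equality)
  show "bounded_operator S \<and> (\<forall>x y. cinner (T x) y = cinner x (S y))"
    using assms by blast
  show "S' = S" if "bounded_operator S' \<and> (\<forall>x y. cinner (T x) y = cinner x (S' y))" for S'
  proof
    show "S' y = S y" for y
      by (rule cinner_left_eqI) (use that in \<open>simp flip: assms(2)\<close>)
  qed
qed

lemma
  assumes "bounded_operator T"
  shows bounded_operator_cadjoint: "bounded_operator (cadjoint T)"
    and cinner_cadjoint: "cinner (T x) y = cinner x (cadjoint T y)"
proof -
  obtain S where "bounded_operator S" and S: "\<And>x y. cinner (T x) y = cinner x (S y)"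
    using adjoint_exists[OF assms] by blast
  moreover from this have "cadjoint T = S"
    by (rule adjoint_unique)
  ultimately show "bounded_operator (cadjoint T)" and "cinner (T x) y = cinner x (cadjoint T y)"
    by simp_all
qed

lemma cadjoint_cadjoint:
  assumes "bounded_operator T"
  shows "cadjoint (cadjoint T) = T"
proof (rule adjoint_unique)
  show "cinner (cadjoint T x) y = cinner x (T y)" for x y
    unfolding cinner_commute[of x "T y"] cinner_cadjoint[OF assms] by (rule cinner_commute)
qed fact

lemma bounded_operator_comp:
  "bounded_operator S \<Longrightarrow> bounded_operator T \<Longrightarrow> bounded_operator (S \<circ> T)"
  using bounded_linear_compose[of S T] by (simp add: bounded_operator_def o_def)

lemma cadjoint_comp:
  assumes "bounded_operator S" and "bounded_operator T"
  shows "cadjoint (S \<circ> T) = cadjoint T \<circ> cadjoint S"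
  using assms
  by (intro adjoint_unique bounded_operator_comp bounded_operator_cadjoint)
    (simp_all add: cinner_cadjoint)

section \<open>Ranges of products\<close>

text \<open>
  The kernel of \<open>T\<close> is the orthogonal complement of \<open>range (cadjoint T)\<close>. If this is also the range
  of \<open>T\<close>, then projecting onto it splits every vector into a value of \<open>T\<close> and an element of the kernel,
  and a vector in both summands is orthogonal to itself.
\<close>

lemma range_kernel_complementary:
  fixes T :: "'a::complex_hilbert_space \<Rightarrow> 'a"
  assumes T: "bounded_operator T" and "closed (range T)"
    and eq: "range T = range (cadjoint T)"
  shows "\<exists>u. T (x - T u) = 0"
    and "T (T u) = 0 \<Longrightarrow> T u = 0"
proof -
  interpret T: bounded_linear T
    using T by (simp add: bounded_operator_def)
  have scale: "T (c *\<^sub>C x) = c *\<^sub>C T x" for c x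
    using T by (simp add: bounded_operator_def)
  have ker: "T k = 0 \<longleftrightarrow> (\<forall>y. cinner k (T y) = 0)" for k
  proof -
    have "T k = 0 \<longleftrightarrow> (\<forall>y. cinner (T k) y = 0)"
      by (metis cinner_self_eq_zero cinner_zero_left)
    also have "\<dots> \<longleftrightarrow> (\<forall>v\<in>range (cadjoint T). cinner k v = 0)"
      by (simp add: cinner_cadjoint[OF T])
    finally show ?thesis
      by (simp flip: eq)
  qed
  have "0 \<in> range T"
    by (metis T.zero rangeI)
  moreover have "v + w \<in> range T" if "v \<in> range T" "w \<in> range T" for v w
    using that by (auto simp flip: T.add)
  moreover have "c *\<^sub>C v \<in> range T" if "v \<in> range T" for c v
    using that by (auto simp flip: scale)
  ultimately have "\<exists>p\<in>range T. \<forall>m\<in>range T. cinner (x - p) m = 0"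
    using \<open>closed (range T)\<close> by (intro orthogonal_projection_exists)
  then show "\<exists>u. T (x - T u) = 0"
    unfolding ker by blast
  show "T u = 0" if "T (T u) = 0"
    using that ker[of "T u"] cinner_self_eq_zero by blast
qed

text \<open>
  Since \<open>T\<close> maps the range and the kernel of \<open>A\<close> into themselves, it acts separately on the two
  summands; a value of \<open>T\<close> in the range of \<open>A\<close> is therefore already attained on the range of \<open>A\<close>.
\<close>

lemma range_comp_eq_Int:
  fixes A T :: "'a::ab_group_add \<Rightarrow> 'a"
  assumes A: "Modules.additive A" and T: "Modules.additive T" and comm: "A \<circ> T = T \<circ> A"
    and sum: "\<And>x. \<exists>u. A (x - A u) = 0"
    and direct: "\<And>u. A (A u) = 0 \<Longrightarrow> A u = 0"
  shows "range (A \<circ> T) = range A \<inter> range T"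
proof
  have AT: "A (T x) = T (A x)" for x
    using comm by (metis comp_apply)
  then have "(A \<circ> T) x \<in> range A \<inter> range T" for x
    by (metis IntI comp_apply rangeI)
  then show "range (A \<circ> T) \<subseteq> range A \<inter> range T"
    by blast
  show "range A \<inter> range T \<subseteq> range (A \<circ> T)"
  proof
    fix y
    assume "y \<in> range A \<inter> range T"
    then obtain w x where w: "y = A w" and x: "y = T x"
      by blast
    obtain u where u: "A (x - A u) = 0"
      using sum by blast
    have Tk: "T (x - A u) = A (w - T u)"
      by (simp add: Modules.additive.diff[OF A] Modules.additive.diff[OF T] AT flip: w x)
    have "A (T (x - A u)) = 0"
      by (simp only: AT u Modules.additive.zero[OF T])
    then have "A (w - T u) = 0"
      unfolding Tk by (rule direct)
    then have "y = A (T u)"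
      by (simp add: Modules.additive.diff[OF A] w)
    then show "y \<in> range (A \<circ> T)"
      by auto
  qed
qed

lemma bounded_operator_additive: "bounded_operator T \<Longrightarrow> Modules.additive T"
  by (simp add: bounded_operator_def Modules.additive_def bounded_linear.linear linear_add)

lemma range_comp_of_range_eq_cadjoint:
  assumes A: "bounded_operator A" and T: "bounded_operator T" and "A \<circ> T = T \<circ> A"
    and closed: "closed (range A)" and eq: "range A = range (cadjoint A)"
  shows "range (A \<circ> T) = range A \<inter> range T"
  using bounded_operator_additive[OF A] bounded_operator_additive[OF T] assms(3)
    range_kernel_complementary[OF A closed eq]
  by (rule range_comp_eq_Int)

theorem theorem4p6:
  fixes A B :: "'a::complex_hilbert_space \<Rightarrow> 'a"
  assumes "bounded_operator A" and "bounded_operator B"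
    and "A \<circ> B = B \<circ> A"
    and "closed (range A)" and "closed (range B)"
    and "posinormal A" and "coposinormal A"
    and "posinormal B"
  shows "posinormal (A \<circ> B) \<and> closed (range (A \<circ> B))"
proof
  note A = assms(1) and B = assms(2)
  have eq: "range A = range (cadjoint A)"
    using assms(6,7) by (auto simp: posinormal_def coposinormal_def cadjoint_cadjoint[OF A])
  have range_AB: "range (A \<circ> B) = range A \<inter> range B"
    using A B assms(3,4) eq by (rule range_comp_of_range_eq_cadjoint)
  then show "closed (range (A \<circ> B))"
    using assms(4,5) by (simp add: closed_Int)
  have adj: "cadjoint (A \<circ> B) = cadjoint A \<circ> cadjoint B"
    using cadjoint_comp[OF B A] assms(3) by simp
  have "cadjoint A \<circ> cadjoint B = cadjoint B \<circ> cadjoint A"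
    using adj cadjoint_comp[OF A B] by simp
  then have "range (cadjoint A \<circ> cadjoint B) = range (cadjoint A) \<inter> range (cadjoint B)"
    using assms(4) eq
    by (intro range_comp_of_range_eq_cadjoint bounded_operator_cadjoint A B)
      (simp_all add: cadjoint_cadjoint[OF A])
  then show "posinormal (A \<circ> B)"
    using range_AB eq assms(8) by (auto simp: posinormal_def adj)
qed

end
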